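(* $\overline{\mathcal{P}}$ is polynomially convex, i.e. for every $x\in\mathbb{C}^3\setminus\overline{\mathcal{P}}$ there is a polynomial $f$ in three variables with $|f|\le1$ on $\overline{\mathcal{P}}$ and $|f(x)|>1$. Moreover $\mathcal{P}$ is polynomially convex in the sense that for every compact $K\subset\mathcal{P}$ the polynomial hull $\widehat K=\{x\in\mathbb{C}^3: |f(x)|\le\sup_K|f| \text{ for all polynomials } f\}$ is contained in $\mathcal{P}$.
   Context: $\mathbb{B}$ is the open unit ball of $\mathbb{C}^{2\times 2}$ (operator norm), $\pi(A)=(a_{21},\operatorname{tr}A,\det A)$, $\mathcal{P}=\pi(\mathbb{B})$, $\overline{\mathcal{P}}$ its closure. *)

theory Defs
  imports "HOL-Analysis.Analysis"
begin

definition Bmat :: "(complex^2^2) set" where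
  "Bmat = {A. onorm (\<lambda>v::complex^2. A *v v) < 1}"

definition piP :: "complex^2^2 \<Rightarrow> complex \<times> complex \<times> complex" where
  "piP A = (A $ 2 $ 1, trace A, det A)"

definition Pset :: "(complex \<times> complex \<times> complex) set" where
  "Pset = piP ` Bmat"

definition poly3 :: "(complex \<times> complex \<times> complex \<Rightarrow> complex) \<Rightarrow> bool" where
  "poly3 f \<longleftrightarrow> (\<exists>(n::nat) (c::nat \<Rightarrow> nat \<Rightarrow> nat \<Rightarrow> complex).
     \<forall>x y z. f (x, y, z) = (\<Sum>i\<le>n. \<Sum>j\<le>n. \<Sum>k\<le>n. c i j k * x ^ i * y ^ j * z ^ k))"

text \<open>Polynomial hull: |f(x)| \<le> sup_K |f| for all polynomials f
  (phrased via all upper bounds M of |f| on K).\<close>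
definition poly_hull :: "(complex \<times> complex \<times> complex) set \<Rightarrow> (complex \<times> complex \<times> complex) set" where
  "poly_hull K = {x. \<forall>f M. poly3 f \<longrightarrow> (\<forall>k\<in>K. norm (f k) \<le> M) \<longrightarrow> norm (f x) \<le> M}"

end

theory Submission
  imports Defs
begin

text \<open>For \<open>z\<close> in the open unit disc the lower left entry of the Moebius transform
  \<open>(A - cnj z)(1 - zA)\<^sup>-\<^sup>1\<close> of a contraction \<open>A\<close> is \<open>a (1 - |z|\<^sup>2) / (1 - s z + p z\<^sup>2)\<close>
  with \<open>(a, s, p) = piP A\<close>, so this function is bounded by \<open>1\<close> on the closure of \<open>Pset\<close>.
  Conversely, if \<open>s = l + m\<close> and \<open>p = l m\<close> with \<open>l\<close>, \<open>m\<close> in the disc, the bound for the single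
  \<open>z\<close> whose transformation makes \<open>l\<close> and \<open>m\<close> opposite already yields a contraction over
  \<open>(a, s, p)\<close>. A point outside the closure is therefore separated either by a power sum
  \<open>l\<^sup>n + m\<^sup>n\<close> or by a partial sum of the power series in \<open>z\<close> of one of these functions.
  The open set follows by scaling: \<open>piP\<close> maps the unit ball to an open set, so a compact subset
  of it lies in the image of a smaller ball.\<close>

subsection \<open>Contractive two-by-two matrices\<close>

lemma norm_sq_vec2: "(norm (v::complex^2))\<^sup>2 = (cmod (v$1))\<^sup>2 + (cmod (v$2))\<^sup>2"
  by (simp add: norm_vec_def L2_set_def sum_2)

lemma matrix_vector_mult_2:
  fixes A :: "complex^2^2"
  shows "(A *v v) $ 1 = A$1$1 * v$1 + A$1$2 * v$2"
    and "(A *v v) $ 2 = A$2$1 * v$1 + A$2$2 * v$2"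
  by (simp_all add: matrix_vector_mult_def sum_2)

lemma bounded_linear_matrix_vector_mult_2:
  "bounded_linear (\<lambda>v::complex^2. (A::complex^2^2) *v v)"
  unfolding linear_conv_bounded_linear[symmetric]
  by (rule linearI) (simp_all add: vec_eq_iff forall_2 matrix_vector_mult_2 algebra_simps)

text \<open>The closed unit ball of the operator norm, written vector by vector: closedness is then
  an intersection of closed conditions, and a matrix is shown to belong by estimating vectors
  only.\<close>

definition contractive :: "complex^2^2 \<Rightarrow> bool" where
  "contractive A \<longleftrightarrow> (\<forall>v. norm (A *v v) \<le> norm v)"

lemma Bmat_contractive:
  assumes "A \<in> Bmat" shows "contractive A"
  unfolding contractive_def
proof
  fix v
  have "norm (A *v v) \<le> onorm (\<lambda>v. A *v v) * norm v"
    by (rule onorm[OF bounded_linear_matrix_vector_mult_2])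
  also have "\<dots> \<le> 1 * norm v"
    using assms by (intro mult_right_mono) (auto simp: Bmat_def)
  finally show "norm (A *v v) \<le> norm v" by simp
qed

lemma scaleR_matrix_vector_mult_2: "(r *\<^sub>R A) *v v = r *\<^sub>R (A *v v)" for A :: "complex^2^2"
  by (simp add: vec_eq_iff forall_2 matrix_vector_mult_2 algebra_simps)

lemma scaleR_contractive_Bmat:
  assumes "contractive A" "0 \<le> r" "r < 1" shows "r *\<^sub>R A \<in> Bmat"
proof -
  have "onorm (\<lambda>v. (r *\<^sub>R A) *v v) \<le> r"
    using assms
    by (intro onorm_le) (auto simp: scaleR_matrix_vector_mult_2 contractive_def intro!: mult_left_mono)
  thus ?thesis using assms by (simp add: Bmat_def)
qed

lemma contractive_entry:
  assumes "contractive A" shows "cmod (A$i$j) \<le> 1"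
proof -
  have "(A *v axis j 1) $ i = A$i$j"
    by (simp add: matrix_vector_mult_def axis_def if_distrib cong: if_cong)
  hence "cmod (A$i$j) \<le> norm (A *v axis j 1)" by (metis Finite_Cartesian_Product.norm_nth_le)
  also have "\<dots> \<le> norm (axis j 1 :: complex^2)" using assms unfolding contractive_def by blast
  finally show ?thesis by simp
qed

lemma compact_contractive: "compact (Collect contractive)"
  unfolding compact_eq_bounded_closed
proof
  have "norm A \<le> 4" if "contractive A" for A
  proof -
    have "norm A \<le> (\<Sum>i\<in>UNIV. norm (A$i))"
      by (simp add: norm_vec_def L2_set_le_sum)
    also have "\<dots> \<le> (\<Sum>i\<in>UNIV. \<Sum>j\<in>UNIV. norm (A$i$j))"
      by (intro sum_mono) (simp add: norm_vec_def L2_set_le_sum)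
    also have "\<dots> \<le> (\<Sum>i\<in>(UNIV::2 set). \<Sum>j\<in>(UNIV::2 set). 1)"
      by (intro sum_mono contractive_entry that)
    finally show ?thesis by simp
  qed
  thus "bounded (Collect contractive)" unfolding bounded_iff by blast
  have "continuous_on UNIV (\<lambda>A::complex^2^2. A *v v)" for v :: "complex^2"
    unfolding matrix_vector_mult_def by (intro continuous_intros)
  hence "closed {A::complex^2^2. norm (A *v v) \<le> norm v}" for v :: "complex^2"
    by (intro closed_Collect_le continuous_intros)
  thus "closed (Collect contractive)"
    unfolding contractive_def by (intro closed_Collect_all)
qed

lemma piP_2: "piP A = (A$2$1, A$1$1 + A$2$2, A$1$1 * A$2$2 - A$1$2 * A$2$1)"
  by (simp add: piP_def trace_def det_2 sum_2)

lemma continuous_on_piP: "continuous_on S piP"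
  unfolding piP_2 by (intro continuous_intros)

text \<open>The image of the compact closed ball is compact, hence closed. So every point of the
  closure lifts to an honest contraction; \<open>piP_contractive_closure\<close> gives the
  converse.\<close>

lemma closure_Pset_subset: "closure Pset \<subseteq> piP ` Collect contractive"
proof (rule closure_minimal)
  show "Pset \<subseteq> piP ` Collect contractive"
    unfolding Pset_def using Bmat_contractive by blast
  show "closed (piP ` Collect contractive)"
    by (intro compact_imp_closed compact_continuous_image continuous_on_piP compact_contractive)
qed

text \<open>Scaling a matrix by \<open>r\<close> scales its entries and its trace by
  \<open>r\<close> but its determinant by the square of \<open>r\<close>, whence the weights 1, 1,
  2.\<close>

definition dilate :: "real \<Rightarrow> complex \<times> complex \<times> complex \<Rightarrow> complex \<times> complex \<times> complex" where
  "dilate r = (\<lambda>(a, s, p). (of_real r * a, of_real r * s, of_real (r\<^sup>2) * p))"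

lemma dilate_piP: "dilate r (piP A) = piP (r *\<^sub>R A)"
  by (simp add: dilate_def piP_2 scaleR_conv_of_real[where 'a=complex] power2_eq_square algebra_simps)

lemma dilate_dilate: "dilate r (dilate t x) = dilate (r * t) x"
  by (cases x) (simp add: dilate_def power_mult_distrib)

lemma dilate_1 [simp]: "dilate 1 x = x"
  by (cases x) (simp add: dilate_def)

lemma continuous_on_dilate: "continuous_on S (dilate r)"
  unfolding dilate_def case_prod_unfold by (intro continuous_intros)

lemma tendsto_dilate_1: "((\<lambda>r. dilate r x) \<longlongrightarrow> x) (at_left 1)"
proof -
  have "((\<lambda>r. dilate r x) \<longlongrightarrow> dilate 1 x) (at_left 1)"
    unfolding dilate_def case_prod_unfold by (intro tendsto_intros)
  thus ?thesis by simp
qed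

lemma dilate_piP_contractive:
  assumes "contractive A" "0 \<le> r" "r < 1" shows "dilate r (piP A) \<in> Pset"
  unfolding dilate_piP Pset_def using scaleR_contractive_Bmat[OF assms] by blast

lemma piP_contractive_closure:
  assumes "contractive A" shows "piP A \<in> closure Pset"
proof (rule Lim_in_closed_set)
  show "((\<lambda>r. dilate r (piP A)) \<longlongrightarrow> piP A) (at_left 1)" by (rule tendsto_dilate_1)
  have "\<forall>\<^sub>F r::real in at_left 1. r \<in> {0<..<1}"
    by (intro eventually_at_leftI[of 0]) auto
  thus "\<forall>\<^sub>F r in at_left 1. dilate r (piP A) \<in> closure Pset"
    by eventually_elim (use assms dilate_piP_contractive closure_subset in fastforce)
qed auto

subsection \<open>Necessary conditions\<close>

text \<open>After expanding the squares the mixed terms in \<open>x\<close> and \<open>y\<close>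
  cancel. This is the identity behind the invariance of the disc under Moebius maps.\<close>

lemma cmod_moebius_identity:
  "(cmod (x - cnj z * y))\<^sup>2 - (cmod (y - z * x))\<^sup>2 = (1 - (cmod z)\<^sup>2) * ((cmod x)\<^sup>2 - (cmod y)\<^sup>2)"
  unfolding cmod_power2 by (simp add: algebra_simps power2_eq_square)

text \<open>With \<open>x = A *v y\<close> the two sides are the norms of
  \<open>(A - cnj z) y\<close> and \<open>(1 - zA) y\<close>, so this says that Moebius transforms
  of contractions are contractions, without inverting a matrix.\<close>

lemma norm_moebius_le:
  fixes x y :: "complex^2"
  assumes "norm x \<le> norm y" "cmod z \<le> 1"
  shows "norm (x - cnj z *s y) \<le> norm (y - z *s x)"
proof (rule power2_le_imp_le)
  have "(norm (x - cnj z *s y))\<^sup>2 - (norm (y - z *s x))\<^sup>2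
      = (1 - (cmod z)\<^sup>2) * ((norm x)\<^sup>2 - (norm y)\<^sup>2)"
    using cmod_moebius_identity[of "x$1" z "y$1"] cmod_moebius_identity[of "x$2" z "y$2"]
    by (simp add: norm_sq_vec2 algebra_simps)
  also have "\<dots> \<le> 0"
    using assms by (intro mult_nonneg_nonpos) (auto simp: power_le_one)
  finally show "(norm (x - cnj z *s y))\<^sup>2 \<le> (norm (y - z *s x))\<^sup>2" by simp
qed auto

text \<open>The left-hand side over the right-hand side is the modulus of the lower left entry of the
  Moebius transform \<open>(A - cnj z)(1 - zA)\<^sup>-\<^sup>1\<close>, a contraction; the vector \<open>v\<close> is the first
  column of the adjugate of \<open>1 - zA\<close>.\<close>
lemma contractive_piP_bound:
  assumes "contractive A" "piP A = (a, s, p)" "cmod z \<le> 1"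
  shows "cmod a * (1 - (cmod z)\<^sup>2) \<le> cmod (1 - s * z + p * z\<^sup>2)"
proof -
  define v :: "complex^2" where "v = vector [1 - z * A$2$2, z * A$2$1]"
  have asp: "a = A$2$1" "s = A$1$1 + A$2$2" "p = A$1$1 * A$2$2 - A$1$2 * A$2$1"
    using assms(2) by (auto simp: piP_2)
  have le: "norm (A *v v - cnj z *s v) \<le> norm (v - z *s (A *v v))"
    using assms by (intro norm_moebius_le) (auto simp: contractive_def)
  have "(A *v v - cnj z *s v) $ 2 = a * (1 - z * cnj z)"
    by (simp add: v_def matrix_vector_mult_2 asp algebra_simps)
  also have "\<dots> = a * of_real (1 - (cmod z)\<^sup>2)"
    by (simp only: of_real_diff of_real_1 complex_norm_square)
  finally have "cmod ((A *v v - cnj z *s v) $ 2) = cmod a * \<bar>1 - (cmod z)\<^sup>2\<bar>"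
    by (simp only: norm_mult norm_of_real)
  hence "cmod a * (1 - (cmod z)\<^sup>2) \<le> cmod ((A *v v - cnj z *s v) $ 2)"
    by (simp add: mult_left_mono)
  also have "\<dots> \<le> norm (A *v v - cnj z *s v)" by (rule Finite_Cartesian_Product.norm_nth_le)
  also note le
  \<comment> \<open>A matrix times the first column of its adjugate is its determinant times the
    first unit vector, and \<open>det (1 - zA)\<close> is \<open>1 - s z + p z^2\<close>.\<close>
  also have "v - z *s (A *v v) = vector [1 - s * z + p * z\<^sup>2, 0]"
    by (simp add: vec_eq_iff forall_2 v_def matrix_vector_mult_2 asp algebra_simps power2_eq_square)
  also have "norm (vector [1 - s * z + p * z\<^sup>2, 0] :: complex^2) = cmod (1 - s * z + p * z\<^sup>2)"
    by (rule power2_eq_imp_eq) (simp_all add: norm_sq_vec2)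
  finally show ?thesis .
qed

lemma quadratic_roots_exist: "\<exists>l m. s = l + m \<and> p = l * (m::complex)"
proof (intro exI conjI)
  let ?d = "csqrt (s\<^sup>2 / 4 - p)"
  show "s = (s / 2 + ?d) + (s / 2 - ?d)" by simp
  have "?d * ?d = s\<^sup>2 / 4 - p" by (metis power2_csqrt power2_eq_square)
  thus "p = (s / 2 + ?d) * (s / 2 - ?d)" by (simp add: algebra_simps power2_eq_square)
qed

text \<open>\<open>l\<close> is a root of the characteristic polynomial, hence an eigenvalue, and a
  contraction cannot lengthen an eigenvector.\<close>

lemma contractive_root_bound:
  assumes "contractive A" "piP A = (a, l + m, l * m)"
  shows "cmod l \<le> 1"
proof -
  have "det (A - mat l) = 0"
  proof -
    have "A$1$1 + A$2$2 = l + m" "A$1$1 * A$2$2 - A$1$2 * A$2$1 = l * m"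
      using assms(2) by (auto simp: piP_2)
    moreover have "det (A - mat l) = A$1$1 * A$2$2 - A$1$2 * A$2$1 - l * (A$1$1 + A$2$2) + l * l"
      by (simp add: det_2 mat_def algebra_simps)
    ultimately show ?thesis by (simp add: algebra_simps)
  qed
  then obtain v where v: "v \<noteq> 0" "(A - mat l) *v v = 0"
    by (metis invertible_det_nz invertible_left_inverse matrix_left_invertible_ker)
  have "A *v v = l *s v"
    using v(2) by (simp add: vec_eq_iff forall_2 matrix_vector_mult_2 mat_def algebra_simps)
  moreover have "norm (l *s v) = cmod l * norm v"
    by (rule power2_eq_imp_eq) (simp_all add: norm_sq_vec2 norm_mult power_mult_distrib algebra_simps)
  ultimately have "cmod l * norm v \<le> norm v" using assms(1) by (metis contractive_def)
  thus ?thesis using v(1) by simp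
qed

lemma Pset_roots:
  assumes "x \<in> Pset"
  obtains A a l m where "contractive A" "piP A = x" "x = (a, l + m, l * m)" "cmod l \<le> 1" "cmod m \<le> 1"
proof -
  obtain A where A: "contractive A" "piP A = x" using assms Bmat_contractive unfolding Pset_def by blast
  obtain a s p where x: "x = (a, s, p)" by (cases x)
  obtain l m where lm: "s = l + m" "p = l * m" using quadratic_roots_exist by blast
  have "cmod l \<le> 1" "cmod m \<le> 1"
    using contractive_root_bound[OF A(1), of a l m] contractive_root_bound[OF A(1), of a m l] A(2) x lm
    by (simp_all add: add.commute mult.commute)
  thus ?thesis using that A x lm by blast
qed

subsection \<open>Polynomials in three variables\<close>

lemma poly3_monomial: "poly3 (\<lambda>(x, y, z). c * x ^ i * y ^ j * z ^ k)"
  unfolding poly3_def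
proof (intro exI allI)
  fix x y z :: complex
  \<comment> \<open>Any common bound of the three exponents would do. The nested conditionals in
    \<open>?c\<close> let the three sums collapse one at a time.\<close>
  let ?n = "i + j + k"
  let ?c = "\<lambda>i' j' k'. if i' = i then if j' = j then if k' = k then c else 0 else 0 else 0"
  have single: "(\<Sum>t\<le>?n. F t) = F u" if "u \<le> ?n" "\<And>t. t \<noteq> u \<Longrightarrow> F t = 0" for F :: "nat \<Rightarrow> complex" and u
    using sum.mono_neutral_right[of "{..?n}" "{u}" F] that by auto
  have "(\<Sum>i'\<le>?n. \<Sum>j'\<le>?n. \<Sum>k'\<le>?n. ?c i' j' k' * x ^ i' * y ^ j' * z ^ k')
      = (\<Sum>j'\<le>?n. \<Sum>k'\<le>?n. ?c i j' k' * x ^ i * y ^ j' * z ^ k')"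
    by (rule single) auto
  also have "\<dots> = (\<Sum>k'\<le>?n. ?c i j k' * x ^ i * y ^ j * z ^ k')"
    by (rule single) auto
  also have "\<dots> = ?c i j k * x ^ i * y ^ j * z ^ k"
    by (rule single) auto
  finally show "(case (x, y, z) of (x, y, z) \<Rightarrow> c * x ^ i * y ^ j * z ^ k)
      = (\<Sum>i'\<le>?n. \<Sum>j'\<le>?n. \<Sum>k'\<le>?n. ?c i' j' k' * x ^ i' * y ^ j' * z ^ k')" by simp
qed

lemma poly3_const: "poly3 (\<lambda>_. c)"
  using poly3_monomial[of c 0 0 0] by (simp add: case_prod_unfold)

lemma poly3_fst: "poly3 (\<lambda>x. fst x)"
  using poly3_monomial[of 1 1 0 0] by (simp add: case_prod_unfold)

lemma poly3_fst_snd: "poly3 (\<lambda>x. fst (snd x))"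
  using poly3_monomial[of 1 0 1 0] by (simp add: case_prod_unfold)

lemma poly3_snd_snd: "poly3 (\<lambda>x. snd (snd x))"
  using poly3_monomial[of 1 0 0 1] by (simp add: case_prod_unfold)

text \<open>Zero coefficients raise the degree bound, so that two polynomials can be written with
  the same bound and added coefficientwise.\<close>

lemma poly3_pad:
  fixes x y z :: complex
  assumes "n \<le> N"
  shows "(\<Sum>i\<le>n. \<Sum>j\<le>n. \<Sum>k\<le>n. c i j k * x ^ i * y ^ j * z ^ k)
    = (\<Sum>i\<le>N. \<Sum>j\<le>N. \<Sum>k\<le>N. (if i \<le> n \<and> j \<le> n \<and> k \<le> n then c i j k else 0) * x ^ i * y ^ j * z ^ k)"
    (is "?l = ?r")
proof -
  have "?r = (\<Sum>i\<le>n. \<Sum>j\<le>N. \<Sum>k\<le>N. (if i \<le> n \<and> j \<le> n \<and> k \<le> n then c i j k else 0) * x ^ i * y ^ j * z ^ k)"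
    using assms by (intro sum.mono_neutral_right) auto
  also have "\<dots> = (\<Sum>i\<le>n. \<Sum>j\<le>n. \<Sum>k\<le>N. (if i \<le> n \<and> j \<le> n \<and> k \<le> n then c i j k else 0) * x ^ i * y ^ j * z ^ k)"
    using assms by (intro sum.cong refl sum.mono_neutral_right) auto
  also have "\<dots> = (\<Sum>i\<le>n. \<Sum>j\<le>n. \<Sum>k\<le>n. (if i \<le> n \<and> j \<le> n \<and> k \<le> n then c i j k else 0) * x ^ i * y ^ j * z ^ k)"
    using assms by (intro sum.cong refl sum.mono_neutral_right) auto
  also have "\<dots> = ?l" by (intro sum.cong refl) auto
  finally show ?thesis by simp
qed

lemma poly3_add:
  assumes "poly3 f" "poly3 g" shows "poly3 (\<lambda>x. f x + g x)"
proof -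
  obtain n c where f: "f (x, y, z) = (\<Sum>i\<le>n. \<Sum>j\<le>n. \<Sum>k\<le>n. c i j k * x ^ i * y ^ j * z ^ k)" for x y z
    using assms(1) unfolding poly3_def by blast
  obtain m d where g: "g (x, y, z) = (\<Sum>i\<le>m. \<Sum>j\<le>m. \<Sum>k\<le>m. d i j k * x ^ i * y ^ j * z ^ k)" for x y z
    using assms(2) unfolding poly3_def by blast
  show ?thesis
    unfolding poly3_def f g poly3_pad[of n "max n m", simplified] poly3_pad[of m "max n m", simplified]
      sum.distrib[symmetric] distrib_right[symmetric]
    by (rule exI[of _ "max n m"]) (auto intro!: exI)
qed

lemma poly3_sum: "(\<And>t. t \<in> T \<Longrightarrow> poly3 (f t)) \<Longrightarrow> poly3 (\<lambda>x. \<Sum>t\<in>T. f t x)"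
  by (induction T rule: infinite_finite_induct) (simp_all add: poly3_const poly3_add)

lemma poly3_mult:
  assumes "poly3 f" "poly3 g" shows "poly3 (\<lambda>x. f x * g x)"
proof -
  obtain n c where f: "f (x, y, z) = (\<Sum>i\<le>n. \<Sum>j\<le>n. \<Sum>k\<le>n. c i j k * x ^ i * y ^ j * z ^ k)" for x y z
    using assms(1) unfolding poly3_def by blast
  obtain m d where g: "g (x, y, z) = (\<Sum>i\<le>m. \<Sum>j\<le>m. \<Sum>k\<le>m. d i j k * x ^ i * y ^ j * z ^ k)" for x y z
    using assms(2) unfolding poly3_def by blast
  have "poly3 (\<lambda>w. \<Sum>i\<le>n. \<Sum>j\<le>n. \<Sum>k\<le>n. \<Sum>i'\<le>m. \<Sum>j'\<le>m. \<Sum>k'\<le>m.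
      (\<lambda>(x, y, z). (c i j k * d i' j' k') * x ^ (i + i') * y ^ (j + j') * z ^ (k + k')) w)"
    by (intro poly3_sum poly3_monomial)
  also have "(\<lambda>w. \<Sum>i\<le>n. \<Sum>j\<le>n. \<Sum>k\<le>n. \<Sum>i'\<le>m. \<Sum>j'\<le>m. \<Sum>k'\<le>m.
      (\<lambda>(x, y, z). (c i j k * d i' j' k') * x ^ (i + i') * y ^ (j + j') * z ^ (k + k')) w)
      = (\<lambda>w. f w * g w)"
  proof
    fix w :: "complex \<times> complex \<times> complex"
    obtain x y z where w: "w = (x, y, z)" by (cases w)
    show "(\<Sum>i\<le>n. \<Sum>j\<le>n. \<Sum>k\<le>n. \<Sum>i'\<le>m. \<Sum>j'\<le>m. \<Sum>k'\<le>m.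
      (\<lambda>(x, y, z). (c i j k * d i' j' k') * x ^ (i + i') * y ^ (j + j') * z ^ (k + k')) w) = f w * g w"
      unfolding w f g prod.case sum_distrib_right unfolding sum_distrib_left
      by (intro sum.cong refl) (simp add: power_add mult_ac)
  qed
  finally show ?thesis .
qed

lemma poly3_diff:
  assumes "poly3 f" "poly3 g" shows "poly3 (\<lambda>x. f x - g x)"
  using poly3_add[OF assms(1) poly3_mult[OF poly3_const[of "-1"] assms(2)]] by simp

lemma poly3_continuous_on:
  assumes "poly3 f" shows "continuous_on S f"
proof -
  obtain n c where f: "f (x, y, z) = (\<Sum>i\<le>n. \<Sum>j\<le>n. \<Sum>k\<le>n. c i j k * x ^ i * y ^ j * z ^ k)" for x y z
    using assms unfolding poly3_def by blast
  have "f = (\<lambda>w. \<Sum>i\<le>n. \<Sum>j\<le>n. \<Sum>k\<le>n. c i j k * fst w ^ i * fst (snd w) ^ j * snd (snd w) ^ k)"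
    using f by (auto simp: fun_eq_iff)
  thus ?thesis by (auto intro!: continuous_intros)
qed

lemma poly3_closure_bound:
  assumes "poly3 f" "\<And>x. x \<in> S \<Longrightarrow> norm (f x) \<le> M" "x \<in> closure S"
  shows "norm (f x) \<le> M"
  using continuous_on_closure_norm_le[OF poly3_continuous_on[OF assms(1)]] assms by blast

subsection \<open>Symmetric functions of the roots\<close>

text \<open>As functions of \<open>s = l + m\<close> and \<open>p = l * m\<close> these are the complete homogeneous symmetric
  polynomials of \<open>l\<close> and \<open>m\<close> for \<open>c = 1\<close>, and the power sums for \<open>c = 2\<close>.\<close>
fun sym_rec :: "complex \<Rightarrow> nat \<Rightarrow> complex \<Rightarrow> complex \<Rightarrow> complex" where
  "sym_rec c 0 s p = c"
| "sym_rec c (Suc 0) s p = s"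
| "sym_rec c (Suc (Suc n)) s p = s * sym_rec c (Suc n) s p - p * sym_rec c n s p"

lemma poly3_sym_rec: "poly3 (\<lambda>x. sym_rec c n (fst (snd x)) (snd (snd x)))"
  by (induction n rule: induct_nat_012)
    (simp_all add: poly3_const poly3_fst_snd poly3_snd_snd poly3_diff poly3_mult)

lemma power_sum_sym_rec: "sym_rec 2 n (l + m) (l * m) = l ^ n + m ^ n"
  by (induction n rule: induct_nat_012) (simp_all add: algebra_simps)

text \<open>The complete symmetric polynomial is the sum of all \<open>l^i m^j\<close> with
  \<open>i + j\<close> fixed; this splits off the single term free of \<open>l\<close>. Unlike the
  defining recursion, it yields a linear bound on the closed disc.\<close>

lemma complete_sym_rec: "sym_rec 1 (Suc n) (l + m) (l * m) = l * sym_rec 1 n (l + m) (l * m) + m ^ Suc n"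
  by (induction n rule: induct_nat_012) (simp_all add: algebra_simps)

lemma complete_sym_bound:
  assumes "cmod l \<le> 1" "cmod m \<le> 1"
  shows "cmod (sym_rec 1 n (l + m) (l * m)) \<le> real n + 1"
proof (induction n)
  case (Suc n)
  have "cmod (sym_rec 1 (Suc n) (l + m) (l * m))
      \<le> cmod l * cmod (sym_rec 1 n (l + m) (l * m)) + cmod m ^ Suc n"
    unfolding complete_sym_rec by (metis norm_mult norm_power norm_triangle_ineq)
  also have "\<dots> \<le> 1 * (real n + 1) + 1"
    using Suc assms by (intro add_mono mult_mono power_le_one) auto
  finally show ?case by simp
qed simp

text \<open>The generating function of the complete symmetric polynomials is
  \<open>1 / (1 - s z + p z^2)\<close>. For a truncation the recursion cancels all terms except the
  constant and the two of highest degree.\<close>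

lemma complete_sym_partial_sum:
  "(1 - s * z + p * z\<^sup>2) * (\<Sum>n\<le>N. sym_rec 1 n s p * z ^ n)
    = 1 - (sym_rec 1 (Suc N) s p - p * sym_rec 1 N s p * z) * z ^ Suc N"
  by (induction N) (simp_all add: algebra_simps power2_eq_square)

text \<open>The bound does not depend on \<open>l\<close> and \<open>m\<close>, and it tends to 0 in
  \<open>N\<close> when \<open>cmod z < 1\<close>. The factor 4 absorbs
  \<open>(N + 2) + (N + 1)\<close>.\<close>

lemma complete_sym_partial_sum_error:
  assumes "cmod l \<le> 1" "cmod m \<le> 1" "cmod z \<le> 1"
  shows "cmod ((sym_rec 1 (Suc N) (l + m) (l * m) - l * m * sym_rec 1 N (l + m) (l * m) * z) * z ^ Suc N)
    \<le> 4 * (real (Suc N) * cmod z ^ Suc N)"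
proof -
  have "cmod (l * m * sym_rec 1 N (l + m) (l * m) * z) \<le> 1 * 1 * (real N + 1) * 1"
    unfolding norm_mult using assms complete_sym_bound[OF assms(1,2)]
    by (intro mult_mono) auto
  hence "cmod (sym_rec 1 (Suc N) (l + m) (l * m) - l * m * sym_rec 1 N (l + m) (l * m) * z)
      \<le> (real (Suc N) + 1) + (real N + 1)"
    using complete_sym_bound[OF assms(1,2), of "Suc N"]
    by (intro norm_triangle_le_diff add_mono) auto
  also have "\<dots> \<le> 4 * real (Suc N)" by simp
  finally have "cmod (sym_rec 1 (Suc N) (l + m) (l * m) - l * m * sym_rec 1 N (l + m) (l * m) * z) * cmod z ^ Suc N
     \<le> (4 * real (Suc N)) * cmod z ^ Suc N" by (rule mult_right_mono) auto
  thus ?thesis by (simp only: norm_mult norm_power mult.assoc)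
qed

text \<open>The two powers might cancel if \<open>m\<close> were large as well. If all power sums
  were at most 2, then \<open>2 (l m)^n\<close>, the square of one power sum minus another, would be
  at most 6 in modulus; so \<open>l m\<close>, and with it \<open>m\<close>, lies in the closed
  disc, and \<open>l^n\<close> dominates.\<close>

lemma power_sum_exceeds_2:
  assumes "cmod l > 1" shows "\<exists>n. cmod (l ^ n + m ^ n) > 2"
proof (rule ccontr)
  assume "\<not> ?thesis"
  hence le: "cmod (l ^ n + m ^ n) \<le> 2" for n by (meson not_le)
  have "cmod (l * m) ^ n \<le> 3" for n
  proof -
    have "2 * (l * m) ^ n = (l ^ n + m ^ n)\<^sup>2 - (l ^ (2 * n) + m ^ (2 * n))"
      by (simp add: power2_sum power_mult_distrib power_mult[symmetric] mult.commute)
    hence "cmod (2 * (l * m) ^ n) \<le> (cmod (l ^ n + m ^ n))\<^sup>2 + cmod (l ^ (2 * n) + m ^ (2 * n))"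
      by (metis norm_power norm_triangle_ineq4)
    also have "\<dots> \<le> 2\<^sup>2 + 2" by (intro add_mono power_mono le) auto
    finally show ?thesis by (simp add: norm_mult norm_power)
  qed
  hence "cmod (l * m) \<le> 1" by (meson not_le real_arch_pow)
  hence "cmod m \<le> 1"
    using assms by (metis mult_le_cancel_right1 mult_mono norm_ge_zero norm_mult not_le order_trans less_le_not_le mult_less_cancel_right2)
  obtain n where n: "3 < cmod l ^ n" using assms real_arch_pow by blast
  have "cmod l ^ n - cmod m ^ n \<le> cmod (l ^ n + m ^ n)"
    by (metis norm_diff_ineq norm_power)
  moreover have "cmod m ^ n \<le> 1" using \<open>cmod m \<le> 1\<close> by (simp add: power_le_one)
  ultimately show False using n le[of n] by linarith
qed

subsection \<open>Sufficiency\<close>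

lemma contractiveI:
  assumes "\<And>v. (cmod (A$1$1 * v$1 + A$1$2 * v$2))\<^sup>2 + (cmod (A$2$1 * v$1 + A$2$2 * v$2))\<^sup>2
             \<le> (cmod (v$1))\<^sup>2 + (cmod ((v::complex^2)$2))\<^sup>2"
  shows "contractive A"
  unfolding contractive_def
proof
  fix v
  have "(norm (A *v v))\<^sup>2 \<le> (norm v)\<^sup>2"
    unfolding norm_sq_vec2 matrix_vector_mult_2 by (rule assms)
  thus "norm (A *v v) \<le> norm v" by (rule power2_le_imp_le) simp
qed

text \<open>An antidiagonal matrix works if \<open>cmod q \<le> (cmod c)\<^sup>2\<close>, otherwise a multiple of a unitary one.\<close>
lemma trace_zero_contraction_exists:
  assumes "cmod c \<le> 1" "cmod q \<le> 1"
  shows "\<exists>b d. contractive (vector [vector [d, b], vector [c, - d]]) \<and> - d\<^sup>2 - b * c = q"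
proof (cases "cmod q \<le> (cmod c)\<^sup>2")
  case True
  have "cmod q \<le> cmod c"
    using True assms(1) by (metis norm_ge_zero mult_left_le order_trans power2_eq_square)
  \<comment> \<open>This includes \<open>c = 0\<close>: then \<open>q = 0\<close> as well, and the
    quotient is 0 by convention.\<close>
  hence b: "cmod (q / c) \<le> 1" by (simp add: norm_divide divide_le_eq_1)
  have "contractive (vector [vector [0, - q / c], vector [c, - 0]])"
  proof (rule contractiveI)
    fix v :: "complex^2"
    have "(cmod (q / c))\<^sup>2 * (cmod (v$2))\<^sup>2 + (cmod c)\<^sup>2 * (cmod (v$1))\<^sup>2
        \<le> 1 * (cmod (v$2))\<^sup>2 + 1 * (cmod (v$1))\<^sup>2"
      using b assms(1) by (intro add_mono mult_right_mono power_le_one) auto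
    thus "(cmod ((vector [vector [0, - q / c], vector [c, - 0]] :: complex^2^2)$1$1 * v$1
          + (vector [vector [0, - q / c], vector [c, - 0]] :: complex^2^2)$1$2 * v$2))\<^sup>2
        + (cmod ((vector [vector [0, - q / c], vector [c, - 0]] :: complex^2^2)$2$1 * v$1
          + (vector [vector [0, - q / c], vector [c, - 0]] :: complex^2^2)$2$2 * v$2))\<^sup>2
        \<le> (cmod (v$1))\<^sup>2 + (cmod (v$2))\<^sup>2"
      by (simp add: norm_mult norm_divide power_mult_distrib power_divide)
  qed
  moreover have "- 0\<^sup>2 - (- q / c) * c = q" using True by (cases "c = 0") auto
  ultimately show ?thesis by blast
next
  case False
  define \<delta> where "\<delta> = sqrt (cmod q - (cmod c)\<^sup>2)"
  have \<delta>: "\<delta>\<^sup>2 = cmod q - (cmod c)\<^sup>2" using False by (simp add: \<delta>_def)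
  have q0: "cmod q \<noteq> 0" using False by (metis zero_le_power2)
  \<comment> \<open>A unimodular number whose square turns \<open>cmod q\<close> into
    \<open>- q\<close>; it fixes the phase of the determinant.\<close>
  define u where "u = csqrt (- q / of_real (cmod q))"
  have u2: "u\<^sup>2 = - q / of_real (cmod q)" by (simp add: u_def)
  hence "(cmod u)\<^sup>2 = 1" using q0 by (simp add: norm_power[symmetric] norm_divide)
  hence un: "cmod u = 1" by (simp add: power2_eq_1_iff) (metis norm_ge_zero not_one_le_zero neg_0_le_iff_le)
  hence uu: "u * cnj u = 1" by (simp add: complex_norm_square[symmetric])
  define d where "d = u * of_real \<delta>"
  \<comment> \<open>This choice makes the columns orthogonal and both of squared length
    \<open>cmod q\<close>, so the matrix is \<open>sqrt (cmod q)\<close> times a unitary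
    one.\<close>
  define b where "b = cnj c * u\<^sup>2"
  have db: "d * cnj b = c * cnj d"
    using uu by (simp add: d_def b_def power2_eq_square algebra_simps)
  have dn: "(cmod d)\<^sup>2 = cmod q - (cmod c)\<^sup>2"
    using un \<delta> by (simp add: d_def norm_mult power_mult_distrib)
  have bn: "cmod b = cmod c" using un by (simp add: b_def norm_mult norm_power)
  have "contractive (vector [vector [d, b], vector [c, - d]])"
  proof (rule contractiveI)
    fix v :: "complex^2"
    define x y where "x = v$1" and "y = v$2"
    have "complex_of_real ((cmod (d * x + b * y))\<^sup>2 + (cmod (c * x - d * y))\<^sup>2)
        = of_real ((cmod d)\<^sup>2 + (cmod c)\<^sup>2) * of_real ((cmod x)\<^sup>2)
          + of_real ((cmod b)\<^sup>2 + (cmod d)\<^sup>2) * of_real ((cmod y)\<^sup>2)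
          + (d * cnj b - c * cnj d) * x * cnj y + cnj (d * cnj b - c * cnj d) * cnj x * y"
      unfolding of_real_add complex_norm_square by (simp add: algebra_simps)
    also have "\<dots> = of_real (cmod q * ((cmod x)\<^sup>2 + (cmod y)\<^sup>2))"
      by (simp add: db bn dn algebra_simps)
    finally have "(cmod (d * x + b * y))\<^sup>2 + (cmod (c * x - d * y))\<^sup>2 = cmod q * ((cmod x)\<^sup>2 + (cmod y)\<^sup>2)"
      using of_real_eq_iff by blast
    also have "\<dots> \<le> 1 * ((cmod x)\<^sup>2 + (cmod y)\<^sup>2)" using assms(2) by (intro mult_right_mono) auto
    finally show "(cmod ((vector [vector [d, b], vector [c, - d]] :: complex^2^2)$1$1 * v$1
          + (vector [vector [d, b], vector [c, - d]] :: complex^2^2)$1$2 * v$2))\<^sup>2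
        + (cmod ((vector [vector [d, b], vector [c, - d]] :: complex^2^2)$2$1 * v$1
          + (vector [vector [d, b], vector [c, - d]] :: complex^2^2)$2$2 * v$2))\<^sup>2
        \<le> (cmod (v$1))\<^sup>2 + (cmod (v$2))\<^sup>2"
      by (simp add: x_def y_def)
  qed
  moreover have "- d\<^sup>2 - b * c = q"
  proof -
    have "d\<^sup>2 + b * c = u\<^sup>2 * (of_real (\<delta>\<^sup>2) + c * cnj c)"
      by (simp add: d_def b_def power_mult_distrib algebra_simps)
    also have "\<dots> = u\<^sup>2 * of_real (cmod q)"
      unfolding \<delta> of_real_diff complex_norm_square by simp
    also have "\<dots> = - q" using q0 by (simp add: u2)
    finally show ?thesis by (metis add.inverse_inverse diff_conv_add_uminus minus_add_distrib)
  qed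
  ultimately show ?thesis by blast
qed

text \<open>The point \<open>w\<close> is the hyperbolic midpoint of \<open>l\<close> and \<open>m\<close>: the Moebius transformation that
  moves it to \<open>0\<close> sends \<open>l\<close> and \<open>m\<close> to opposite points.\<close>
lemma hyperbolic_midpoint_exists:
  assumes "cmod l < 1" "cmod m < 1"
  shows "\<exists>w. cmod w < 1 \<and> (l + m) * (1 + of_real ((cmod w)\<^sup>2)) = 2 * w + 2 * cnj w * (l * m)"
proof -
  define s p where "s = l + m" and "p = l * m"
  have p1: "cmod p < 1"
    using mult_strict_mono'[OF assms] by (simp add: p_def norm_mult)
  hence pp: "0 < 1 - (cmod p)\<^sup>2" by (simp add: power_less_one_iff abs_square_less_1)
  have "s - cnj s * p = l * of_real (1 - (cmod m)\<^sup>2) + m * of_real (1 - (cmod l)\<^sup>2)"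
    unfolding of_real_diff complex_norm_square by (simp add: s_def p_def algebra_simps)
  hence "cmod (s - cnj s * p) \<le> cmod (l * of_real (1 - (cmod m)\<^sup>2)) + cmod (m * of_real (1 - (cmod l)\<^sup>2))"
    by (metis norm_triangle_ineq)
  also have "\<dots> = cmod l * (1 - (cmod m)\<^sup>2) + cmod m * (1 - (cmod l)\<^sup>2)"
    unfolding norm_mult norm_of_real using assms by (simp add: abs_of_nonneg power_le_one)
  \<comment> \<open>The sum factors as \<open>(cmod l + cmod m) (1 - cmod p)\<close>, which leaves a
    gap with three positive factors.\<close>
  also have "\<dots> = 1 - (cmod p)\<^sup>2 - (1 - cmod l) * (1 - cmod m) * (1 - cmod p)"
    by (simp add: p_def norm_mult algebra_simps power2_eq_square)
  also have "\<dots> < 1 - (cmod p)\<^sup>2" using assms p1 by simp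
  finally have lt: "cmod (s - cnj s * p) < 1 - (cmod p)\<^sup>2" .
  \<comment> \<open>With \<open>\<beta>\<close> standing for \<open>2 w / (1 + |w|^2)\<close>, the
    required equation reads \<open>s = \<beta> + cnj \<beta> * p\<close>. Eliminating
    \<open>cnj \<beta>\<close> between it and its conjugate gives this formula.\<close>
  define \<beta> where "\<beta> = (s - cnj s * p) / of_real (1 - (cmod p)\<^sup>2)"
  have \<beta>1: "cmod \<beta> < 1"
    unfolding \<beta>_def norm_divide norm_of_real using lt pp by simp
  have s\<beta>: "s = \<beta> + cnj \<beta> * p"
  proof -
    define k where "k = complex_of_real (1 - (cmod p)\<^sup>2)"
    have k: "k \<noteq> 0" "cnj k = k" using pp unfolding k_def by (metis less_irrefl of_real_eq_0_iff) simp
    have "(\<beta> + cnj \<beta> * p) * k = (s - cnj s * p) + (cnj s - s * cnj p) * p"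
      unfolding \<beta>_def k_def[symmetric] using k by (simp add: field_simps)
    also have "\<dots> = s * k"
      unfolding k_def of_real_diff complex_norm_square by (simp add: algebra_simps)
    finally show ?thesis using k by simp
  qed
  \<comment> \<open>It remains to solve \<open>2 w / (1 + |w|^2) = \<beta>\<close>; the solution
    inside the disc is \<open>\<beta> / (1 + t)\<close>.\<close>
  define t where "t = sqrt (1 - (cmod \<beta>)\<^sup>2)"
  have t0: "0 \<le> t" and t2: "t\<^sup>2 = 1 - (cmod \<beta>)\<^sup>2"
    using \<beta>1 by (simp_all add: t_def power_le_one)
  define w where "w = \<beta> / of_real (1 + t)"
  have wn: "cmod w = cmod \<beta> / (1 + t)" unfolding w_def norm_divide norm_of_real using t0 by simp
  also have "\<dots> < 1" using \<beta>1 t0 by (simp add: divide_less_eq)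
  finally have w1: "cmod w < 1" .
  have "(cmod w)\<^sup>2 = (1 - t\<^sup>2) / (1 + t)\<^sup>2" by (simp add: wn power_divide t2)
  also have "\<dots> = (1 - t) * (1 + t) / ((1 + t) * (1 + t))" by (simp add: algebra_simps power2_eq_square)
  also have "\<dots> = (1 - t) / (1 + t)" using t0 by simp
  finally have "1 + (cmod w)\<^sup>2 = 2 / (1 + t)"
    using t0 by (simp add: field_simps)
  hence "\<beta> * of_real (1 + (cmod w)\<^sup>2) = 2 * w"
    by (simp add: w_def)
  moreover from this have "cnj \<beta> * of_real (1 + (cmod w)\<^sup>2) = 2 * cnj w"
    by (metis complex_cnj_mult complex_cnj_complex_of_real complex_cnj_numeral)
  moreover have "s * of_real (1 + (cmod w)\<^sup>2)
      = \<beta> * of_real (1 + (cmod w)\<^sup>2) + cnj \<beta> * of_real (1 + (cmod w)\<^sup>2) * p"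
    by (subst s\<beta>) (simp add: algebra_simps)
  ultimately have "s * of_real (1 + (cmod w)\<^sup>2) = 2 * w + 2 * cnj w * p" by simp
  thus ?thesis using w1 unfolding s_def p_def by auto
qed

lemma one_minus_mult_nonzero:
  assumes "cmod l < 1" "cmod z < 1" shows "1 - l * z \<noteq> 0"
proof -
  have "cmod (l * z) < 1" using mult_strict_mono'[OF assms] by (simp add: norm_mult)
  thus ?thesis by auto
qed

lemma cmod_moebius_le:
  assumes "cmod l \<le> 1" "cmod w \<le> 1"
  shows "cmod (l - w) \<le> cmod (1 - l * cnj w)"
proof (rule power2_le_imp_le)
  have "(1 - (cmod w)\<^sup>2) * ((cmod l)\<^sup>2 - (cmod 1)\<^sup>2) \<le> 0"
    using assms by (intro mult_nonneg_nonpos) (auto simp: power_le_one)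
  moreover have "(cmod (l - w))\<^sup>2 - (cmod (1 - l * cnj w))\<^sup>2 = (1 - (cmod w)\<^sup>2) * ((cmod l)\<^sup>2 - (cmod 1)\<^sup>2)"
    using cmod_moebius_identity[of l "cnj w" 1] by (simp add: mult.commute)
  ultimately show "(cmod (l - w))\<^sup>2 \<le> (cmod (1 - l * cnj w))\<^sup>2" by linarith
qed auto

text \<open>Build the Moebius transform \<open>B\<close> of the required matrix \<open>A\<close>, which has trace zero,
  and transform back: \<open>A = (B + w)(1 + cnj w B)\<^sup>-\<^sup>1\<close>. Since \<open>B\<^sup>2 = - q\<close>, this is
  an affine function of \<open>B\<close>.\<close>
lemma contractive_preimage_exists:
  assumes l: "cmod l < 1" and m: "cmod m < 1"
    and bound: "\<And>z. cmod z < 1 \<Longrightarrow> cmod a * (1 - (cmod z)\<^sup>2) \<le> cmod (1 - (l + m) * z + l * m * z\<^sup>2)"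
  shows "\<exists>A. contractive A \<and> piP A = (a, l + m, l * m)"
proof -
  obtain w where w: "cmod w < 1"
    and mid: "(l + m) * (1 + of_real ((cmod w)\<^sup>2)) = 2 * w + 2 * cnj w * (l * m)"
    using hyperbolic_midpoint_exists[OF l m] by blast
  define r where "r = 1 - (cmod w)\<^sup>2"
  have r0: "r > 0" using w by (simp add: r_def power_less_one_iff abs_square_less_1)
  have r: "of_real r = 1 - w * cnj w" unfolding r_def of_real_diff complex_norm_square by simp
  define v where "v = cnj w"
  define D where "D = (1 - l * v) * (1 - m * v)"
  have D: "D = 1 - (l + m) * v + l * m * v\<^sup>2" by (simp add: D_def algebra_simps power2_eq_square)
  have vw: "cmod v < 1" using w by (simp add: v_def)
  have D0: "D \<noteq> 0" using one_minus_mult_nonzero[OF l vw] one_minus_mult_nonzero[OF m vw] by (simp add: D_def)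
  \<comment> \<open>\<open>c\<close> and \<open>q\<close> are the lower left entry and the
    determinant that the Moebius transform of a matrix over \<open>(a, l + m, l * m)\<close> must
    have. The hypothesis at \<open>z = v\<close> says exactly that
    \<open>cmod c \<le> 1\<close>.\<close>
  define c where "c = a * of_real r / D"
  define q where "q = (l - w) * (m - w) / D"
  have "cmod a * r \<le> cmod D"
    using bound[OF vw] unfolding D[symmetric] r_def by (simp add: v_def)
  hence "cmod c \<le> 1"
    using r0 D0 by (simp add: c_def norm_mult norm_divide)
  moreover have "cmod q \<le> 1"
    using D0 mult_mono[OF cmod_moebius_le[of l w] cmod_moebius_le[of m w]] l m w
    by (simp add: q_def D_def v_def norm_mult norm_divide)
  ultimately obtain b d where B: "contractive (vector [vector [d, b], vector [c, - d]])"
    and detB: "- d\<^sup>2 - b * c = q"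
    using trace_zero_contraction_exists by blast
  define B :: "complex^2^2" where "B = vector [vector [d, b], vector [c, - d]]"
  \<comment> \<open>This is \<open>det (1 + v B)\<close>, because \<open>B\<close> has trace 0 and
    determinant \<open>q\<close>.\<close>
  define E where "E = 1 + v\<^sup>2 * q"
  have mid': "(l + m) * (1 + w * v) = 2 * w + 2 * v * (l * m)"
    using mid by (simp only: complex_norm_square v_def)
  have rv: "of_real r = 1 - w * v" by (simp add: r v_def)
  have Dq: "D * q = (l - w) * (m - w)" using D0 by (simp add: q_def)
  have DE: "D * E = (of_real r)\<^sup>2"
  proof -
    have "D * E = D + v\<^sup>2 * (D * q)" by (simp add: E_def algebra_simps)
    also have "\<dots> = D + v\<^sup>2 * ((l - w) * (m - w))" by (simp only: Dq)
    also have "\<dots> = 1 + (w * v)\<^sup>2 + 2 * (l * m) * v\<^sup>2 - v * ((l + m) * (1 + w * v))"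
      by (simp add: D algebra_simps power2_eq_square)
    also have "\<dots> = (of_real r)\<^sup>2"
      unfolding mid' rv by (simp add: algebra_simps power2_eq_square)
    finally show ?thesis .
  qed
  have E0: "E \<noteq> 0" using DE r0 by (metis mult_zero_right of_real_eq_0_iff less_irrefl zero_eq_power2)
  \<comment> \<open>As \<open>B * B = - q\<close>, the inverse of \<open>1 + v B\<close> is
    \<open>(1 - v B) / E\<close>; multiplying it by \<open>B + w\<close> gives
    \<open>\<alpha> + \<gamma> B\<close>.\<close>
  define \<alpha> \<gamma> where "\<alpha> = (w + v * q) / E" and "\<gamma> = of_real r / E"
  have tr: "2 * \<alpha> = l + m"
  proof -
    have "D * (2 * (w + v * q)) = 2 * (w * D + v * (D * q))"
      by (simp add: algebra_simps)
    also have "\<dots> = 2 * (w * D + v * ((l - w) * (m - w)))" by (simp only: Dq)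
    also have "\<dots> = 2 * (w + v * (l * m)) - 2 * (l + m) * w * v  + 2 * w * v * (l * m * v + w) - (l + m) * 2 * w * v"
      by (simp add: D algebra_simps power2_eq_square)
    also have "\<dots> = (l + m) * (1 + w * v) - 4 * (l + m) * (w * v) + w * v * ((l + m) * (1 + w * v))"
      unfolding mid' by (simp add: algebra_simps)
    also have "\<dots> = (l + m) * (of_real r)\<^sup>2"
      unfolding rv by (simp add: algebra_simps power2_eq_square)
    also have "\<dots> = D * ((l + m) * E)" unfolding DE[symmetric] by simp
    finally have "2 * (w + v * q) = (l + m) * E" using D0 by simp
    thus ?thesis using E0 by (simp add: \<alpha>_def field_simps)
  qed
  have det: "\<alpha>\<^sup>2 + \<gamma>\<^sup>2 * q = l * m"
  proof -
    have "(w + v * q)\<^sup>2 + (1 - w * v)\<^sup>2 * q = (w\<^sup>2 + q) * E"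
      by (simp add: E_def algebra_simps power2_eq_square)
    hence "\<alpha>\<^sup>2 + \<gamma>\<^sup>2 * q = (w\<^sup>2 + q) * E / E\<^sup>2"
      by (simp add: \<alpha>_def \<gamma>_def rv power_divide add_divide_distrib[symmetric])
    also have "\<dots> = (w\<^sup>2 + q) / E" using E0 by (simp add: power2_eq_square)
    also have "\<dots> = l * m"
    proof -
      have "D * (w\<^sup>2 + q) = w\<^sup>2 * D + D * q" by (simp add: algebra_simps)
      also have "\<dots> = w\<^sup>2 * D + (l - w) * (m - w)" by (simp only: Dq)
      also have "\<dots> = 2 * w\<^sup>2 + l * m * (1 + (w * v)\<^sup>2) - w * ((l + m) * (1 + w * v))"
        by (simp add: D algebra_simps power2_eq_square)
      also have "\<dots> = l * m * (of_real r)\<^sup>2"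
        unfolding mid' rv by (simp add: algebra_simps power2_eq_square)
      also have "\<dots> = D * (l * m * E)" unfolding DE[symmetric] by simp
      finally have "w\<^sup>2 + q = l * m * E" using D0 by simp
      thus ?thesis using E0 by simp
    qed
    finally show ?thesis .
  qed
  have a: "\<gamma> * c = a"
  proof -
    have "\<gamma> * c = a * (of_real r)\<^sup>2 / (D * E)"
      by (simp add: \<gamma>_def c_def power2_eq_square mult_ac)
    thus ?thesis unfolding DE[symmetric] using D0 E0 by simp
  qed
  define A :: "complex^2^2" where "A = vector [vector [\<alpha> + \<gamma> * d, \<gamma> * b], vector [\<gamma> * c, \<alpha> - \<gamma> * d]]"
  have "piP A = (\<gamma> * c, 2 * \<alpha>, \<alpha>\<^sup>2 + \<gamma>\<^sup>2 * (- d\<^sup>2 - b * c))"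
    by (simp add: piP_2 A_def algebra_simps power2_eq_square)
  hence "piP A = (a, l + m, l * m)" by (simp only: detB tr det a)
  moreover have "contractive A"
    unfolding contractive_def
  proof
    fix x :: "complex^2"
    define k where "k = 1 / E"
    have kE: "k * E = 1" using E0 by (simp add: k_def)
    have k: "\<alpha> = k * (w + v * q)" "\<gamma> = k * (1 - w * v)"
      by (simp_all add: \<alpha>_def \<gamma>_def k_def rv)
    \<comment> \<open>\<open>y\<close> is the image of \<open>x\<close> under the inverse of
      \<open>1 + v B\<close>. Then \<open>x = y + v B y\<close> and \<open>A x = B y + w y\<close>,
      so \<open>norm_moebius_le\<close> at the parameter \<open>- v\<close> compares their
      norms.\<close>
    define y where "y = k *s (x - v *s (B *v x))"
    have BB: "B *v (B *v z) = (- q) *s z" for z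
      by (simp add: vec_eq_iff forall_2 matrix_vector_mult_2 B_def detB[symmetric] algebra_simps power2_eq_square)
    have By: "B *v y = k *s (B *v x + (v * q) *s x)"
    proof -
      have "B *v y = k *s (B *v x - v *s (B *v (B *v x)))"
        by (simp add: y_def vec.scale vec.diff)
      thus ?thesis unfolding BB by (simp add: vec_eq_iff)
    qed
    have 1: "y - (- v) *s (B *v y) = x"
    proof -
      have "y - (- v) *s (B *v y) = (k * E) *s x"
        unfolding By by (simp add: y_def vec_eq_iff E_def algebra_simps power2_eq_square)
      thus ?thesis by (simp add: kE)
    qed
    have 2: "B *v y - cnj (- v) *s y = A *v x"
    proof -
      have "A *v x = \<alpha> *s x + \<gamma> *s (B *v x)"
        by (simp add: vec_eq_iff forall_2 matrix_vector_mult_2 A_def B_def algebra_simps)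
      also have "\<dots> = k *s (B *v x + (v * q) *s x) + w *s y"
        by (simp add: k y_def vec_eq_iff algebra_simps)
      finally show ?thesis unfolding By by (simp add: vec_eq_iff v_def)
    qed
    have "norm (B *v y - cnj (- v) *s y) \<le> norm (y - (- v) *s (B *v y))"
      using B vw by (intro norm_moebius_le) (auto simp: contractive_def B_def)
    thus "norm (A *v x) \<le> norm x" unfolding 1 2 .
  qed
  ultimately show ?thesis by blast
qed

subsection \<open>Separating polynomials\<close>

text \<open>Half a power sum is bounded by 1 wherever both roots lie in the closed disc, as they do
  over \<open>Pset\<close>, while some power sum exceeds 2 at the given point.\<close>

lemma separate_large_root:
  assumes "cmod l > 1"
  shows "\<exists>f. poly3 f \<and> (\<forall>x\<in>closure Pset. norm (f x) \<le> 1) \<and> norm (f (a, l + m, l * m)) > 1"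
proof -
  obtain n where n: "cmod (l ^ n + m ^ n) > 2" using power_sum_exceeds_2[OF assms] by blast
  define f where "f = (\<lambda>x. (1 / 2) * sym_rec 2 n (fst (snd x)) (snd (snd (x :: complex \<times> complex \<times> complex))))"
  have f: "poly3 f" unfolding f_def by (intro poly3_mult poly3_const poly3_sym_rec)
  have "norm (f x) \<le> 1" if x: "x \<in> Pset" for x
  proof -
    obtain b l' m' where x': "x = (b, l' + m', l' * m')" and "cmod l' \<le> 1" "cmod m' \<le> 1"
      using Pset_roots[OF x] by blast
    hence "cmod l' ^ n \<le> 1" "cmod m' ^ n \<le> 1" by (simp_all add: power_le_one)
    hence "cmod (l' ^ n + m' ^ n) \<le> 2"
      using norm_triangle_ineq[of "l' ^ n" "m' ^ n"] by (simp add: norm_power)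
    thus ?thesis by (simp add: f_def x' power_sum_sym_rec norm_mult)
  qed
  hence "\<forall>x\<in>closure Pset. norm (f x) \<le> 1" using poly3_closure_bound[OF f] by blast
  moreover have "norm (f (a, l + m, l * m)) > 1"
    using n by (simp add: f_def power_sum_sym_rec norm_mult)
  ultimately show ?thesis using f by blast
qed

text \<open>The rational function \<open>a (1 - |z|\<^sup>2) / (1 - s z + p z\<^sup>2)\<close> is bounded by \<open>1\<close> on \<open>Pset\<close>;
  the partial sums of its power series in \<open>z\<close> are polynomials.\<close>
lemma separate_by_partial_sum:
  assumes l: "cmod l \<le> 1" and m: "cmod m \<le> 1" and z: "cmod z < 1"
    and gt: "cmod a * (1 - (cmod z)\<^sup>2) > cmod (1 - (l + m) * z + l * m * z\<^sup>2)"
  shows "\<exists>f. poly3 f \<and> (\<forall>x\<in>closure Pset. norm (f x) \<le> 1) \<and> norm (f (a, l + m, l * m)) > 1"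
proof -
  define \<epsilon> where "\<epsilon> = (\<lambda>N. 4 * (real (Suc N) * cmod z ^ Suc N))"
  define D where "D = cmod (1 - (l + m) * z + l * m * z\<^sup>2)"
  define r where "r = 1 - (cmod z)\<^sup>2"
  have r0: "r > 0" using z by (simp add: r_def power_less_one_iff abs_square_less_1)
  have "(\<lambda>n. real n * cmod z ^ n) \<longlonglongrightarrow> 0"
    using z by (intro powser_times_n_limit_0) simp
  hence \<epsilon>0: "\<epsilon> \<longlonglongrightarrow> 0"
    unfolding \<epsilon>_def by (intro tendsto_mult_right_zero) (rule LIMSEQ_Suc)
  \<comment> \<open>The factor \<open>1 + \<epsilon> N\<close> is lost in normalising the truncation
    on \<open>Pset\<close>, and \<open>1 - \<epsilon> N\<close> in evaluating it at the given point.
    The strict inequality \<open>gt\<close> survives both for large \<open>N\<close>.\<close>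
  have "(\<lambda>N. cmod a * r * (1 - \<epsilon> N) - (1 + \<epsilon> N) * D) \<longlonglongrightarrow> cmod a * r * (1 - 0) - (1 + 0) * D"
    by (intro tendsto_intros \<epsilon>0)
  moreover have "cmod a * r * (1 - 0) - (1 + 0) * D > 0" using gt by (simp add: D_def r_def)
  ultimately have "\<forall>\<^sub>F N in sequentially. cmod a * r * (1 - \<epsilon> N) - (1 + \<epsilon> N) * D > 0"
    by (rule order_tendstoD)
  then obtain N where N: "(1 + \<epsilon> N) * D < cmod a * r * (1 - \<epsilon> N)"
    by (metis (no_types, lifting) eventually_sequentially order_refl diff_gt_0_iff_gt)
  have \<epsilon>N: "\<epsilon> N \<ge> 0" by (simp add: \<epsilon>_def)
  define S where "S = (\<lambda>s p. \<Sum>n\<le>N. sym_rec 1 n s p * z ^ n)"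
  have S: "\<exists>e. cmod e \<le> \<epsilon> N \<and> (1 - (l' + m') * z + l' * m' * z\<^sup>2) * S (l' + m') (l' * m') = 1 - e"
    if "cmod l' \<le> 1" "cmod m' \<le> 1" for l' m'
    unfolding S_def complete_sym_partial_sum \<epsilon>_def
    using complete_sym_partial_sum_error[OF that less_imp_le[OF z]] by blast
  \<comment> \<open>Dividing by \<open>1 + \<epsilon> N\<close> compensates for the truncation
    error, so that the bound on \<open>Pset\<close> is exactly 1.\<close>
  define f where "f = (\<lambda>x. of_real (r / (1 + \<epsilon> N)) * (fst x * S (fst (snd x)) (snd (snd (x :: complex \<times> complex \<times> complex)))))"
  have f: "poly3 f" unfolding f_def S_def
    by (intro poly3_mult poly3_const poly3_sym_rec poly3_sum poly3_fst)
  have fn: "norm (f (b, s, p)) = cmod b * r * cmod (S s p) / (1 + \<epsilon> N)" for b s p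
    unfolding f_def norm_mult norm_of_real using r0 \<epsilon>N by simp
  have "norm (f x) \<le> 1" if x: "x \<in> Pset" for x
  proof -
    obtain A b l' m' where A: "contractive A" "piP A = x" and x: "x = (b, l' + m', l' * m')"
      and "cmod l' \<le> 1" "cmod m' \<le> 1"
      using Pset_roots[OF x] by blast
    define s p where "s = l' + m'" and "p = l' * m'"
    have x': "x = (b, s, p)" by (simp add: x s_def p_def)
    obtain e where e: "cmod e \<le> \<epsilon> N" "(1 - s * z + p * z\<^sup>2) * S s p = 1 - e"
      using S[OF \<open>cmod l' \<le> 1\<close> \<open>cmod m' \<le> 1\<close>] unfolding s_def p_def by blast
    have "cmod b * r \<le> cmod (1 - s * z + p * z\<^sup>2)"
      unfolding r_def using contractive_piP_bound[OF A(1)] A(2) x' z by simp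
    hence "cmod b * r * cmod (S s p) \<le> cmod (1 - s * z + p * z\<^sup>2) * cmod (S s p)"
      by (rule mult_right_mono) simp
    also have "\<dots> = cmod (1 - e)" by (simp only: norm_mult[symmetric] e(2))
    also have "\<dots> \<le> 1 + \<epsilon> N" using norm_triangle_ineq4[of 1 e] e(1) by simp
    finally show ?thesis using \<epsilon>N by (simp add: x' fn)
  qed
  hence "\<forall>x\<in>closure Pset. norm (f x) \<le> 1" using poly3_closure_bound[OF f] by blast
  moreover have "norm (f (a, l + m, l * m)) > 1"
  proof -
    obtain e where e: "cmod e \<le> \<epsilon> N" "(1 - (l + m) * z + l * m * z\<^sup>2) * S (l + m) (l * m) = 1 - e"
      using S[OF l m] by blast
    define T where "T = cmod (S (l + m) (l * m))"
    have "D * T = cmod (1 - e)" by (simp only: D_def T_def norm_mult[symmetric] e(2))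
    moreover have "1 - cmod e \<le> cmod (1 - e)" using norm_triangle_ineq2[of 1 e] by simp
    ultimately have DT: "1 - \<epsilon> N \<le> D * T" using e(1) by linarith
    have a0: "cmod a * r > 0" using gt norm_ge_zero[of "1 - (l + m) * z + l * m * z\<^sup>2"] unfolding r_def by linarith
    have D0: "D \<ge> 0" by (simp add: D_def)
    have "1 - \<epsilon> N > 0"
      using N a0 D0 \<epsilon>N by (metis add_nonneg_nonneg le_less_trans mult_nonneg_nonneg zero_le_one zero_less_mult_pos)
    have "(1 + \<epsilon> N) * (1 - \<epsilon> N) \<le> (1 + \<epsilon> N) * (D * T)"
      using DT \<epsilon>N by (intro mult_left_mono) auto
    also have "\<dots> = ((1 + \<epsilon> N) * D) * T" by simp
    also have "\<dots> < (cmod a * r * (1 - \<epsilon> N)) * T"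
    proof (rule mult_strict_right_mono[OF N])
      have "T \<noteq> 0" using DT \<open>1 - \<epsilon> N > 0\<close> by auto
      thus "T > 0" by (simp add: T_def)
    qed
    also have "\<dots> = (cmod a * r * T) * (1 - \<epsilon> N)" by simp
    finally have "1 + \<epsilon> N < cmod a * r * T" using \<open>1 - \<epsilon> N > 0\<close> by (simp only: mult_less_cancel_right)
    thus ?thesis unfolding fn T_def[symmetric] using \<epsilon>N by (simp add: less_divide_eq)
  qed
  ultimately show ?thesis using f by blast
qed

text \<open>A root outside the closed disc is detected by a power sum. Otherwise a slight dilation
  moves both roots into the open disc and keeps the point outside the closure; having no contraction
  over it, the dilated point violates the bound at some \<open>z\<close>.\<close>

lemma closure_Pset_separation:
  assumes "x \<notin> closure Pset"
  shows "\<exists>f. poly3 f \<and> (\<forall>y\<in>closure Pset. norm (f y) \<le> 1) \<and> norm (f x) > 1"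
proof -
  obtain a s p where x: "x = (a, s, p)" by (cases x)
  obtain l m where lm: "s = l + m" "p = l * m" using quadratic_roots_exist by blast
  consider "cmod l > 1" | "cmod m > 1" | "cmod l \<le> 1" "cmod m \<le> 1" by linarith
  thus ?thesis
  proof cases
    case 1
    thus ?thesis unfolding x lm by (rule separate_large_root)
  next
    case 2
    have "x = (a, m + l, m * l)" by (simp add: x lm add.commute mult.commute)
    thus ?thesis using separate_large_root[OF 2] by simp
  next
    case 3
    have "\<forall>\<^sub>F r in at_left 1. dilate r x \<in> - closure Pset"
      using assms by (intro topological_tendstoD[OF tendsto_dilate_1]) auto
    moreover have "\<forall>\<^sub>F r::real in at_left 1. r \<in> {0<..<1}"
      by (intro eventually_at_leftI[of 0]) auto
    ultimately have "\<forall>\<^sub>F r in at_left 1. dilate r x \<in> - closure Pset \<and> r \<in> {0<..<1}"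
      by eventually_elim blast
    then obtain r where r: "dilate r x \<notin> closure Pset" "0 < r" "r < 1"
      using eventually_happens'[OF trivial_limit_at_left_real] by fastforce
    define R where "R = complex_of_real r"
    have R: "cmod R = r" using r by (simp add: R_def)
    have "cmod (R * l) < 1" "cmod (R * m) < 1"
      unfolding norm_mult R using mult_left_le[OF 3(1), of r] mult_left_le[OF 3(2), of r] r by linarith+
    moreover have "\<nexists>A. contractive A \<and> piP A = (R * a, R * l + R * m, R * l * (R * m))"
    proof
      assume "\<exists>A. contractive A \<and> piP A = (R * a, R * l + R * m, R * l * (R * m))"
      moreover have "dilate r x = (R * a, R * l + R * m, R * l * (R * m))"
        by (simp add: dilate_def x lm R_def power2_eq_square algebra_simps)
      ultimately show False using r(1) piP_contractive_closure by metis
    qed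
    ultimately obtain z where z: "cmod z < 1"
      "cmod (1 - (R * l + R * m) * z + R * l * (R * m) * z\<^sup>2) < cmod (R * a) * (1 - (cmod z)\<^sup>2)"
      using contractive_preimage_exists[of "R * l" "R * m" "R * a"] by (meson not_le)
    show ?thesis unfolding x lm
    \<comment> \<open>The violation at \<open>z\<close> for the dilated point is one at
      \<open>R * z\<close> for the point itself: the quadratic has the same value, and the left
      factor only grows.\<close>
    proof (rule separate_by_partial_sum[OF 3])
      have rz: "cmod (R * z) \<le> cmod z" using r by (simp add: norm_mult R mult_left_le_one_le)
      show "cmod (R * z) < 1" using rz z by simp
      have "1 - (l + m) * (R * z) + l * m * (R * z)\<^sup>2 = 1 - (R * l + R * m) * z + R * l * (R * m) * z\<^sup>2"
        by (simp add: algebra_simps power2_eq_square)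
      also have "cmod \<dots> < cmod (R * a) * (1 - (cmod z)\<^sup>2)" by (rule z(2))
      also have "\<dots> \<le> cmod a * (1 - (cmod (R * z))\<^sup>2)"
        using r rz z by (intro mult_mono) (auto simp: norm_mult R mult_left_le_one_le power_le_one intro!: power_mono)
      finally show "cmod (1 - (l + m) * (R * z) + l * m * (R * z)\<^sup>2) < cmod a * (1 - (cmod (R * z))\<^sup>2)" .
    qed
  qed
qed

subsection \<open>Exhaustion of the open set\<close>

lemma norm_matrix_vector_mult_2_le:
  fixes E :: "complex^2^2"
  shows "norm (E *v v) \<le> (cmod (E$1$1) + cmod (E$1$2) + cmod (E$2$1) + cmod (E$2$2)) * norm v"
proof -
  have "norm (E *v v) \<le> (\<Sum>i\<in>UNIV. cmod ((E *v v)$i))"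
    by (simp add: norm_vec_def L2_set_le_sum)
  also have "\<dots> = cmod (E$1$1 * v$1 + E$1$2 * v$2) + cmod (E$2$1 * v$1 + E$2$2 * v$2)"
    by (simp add: sum_2 matrix_vector_mult_2)
  also have "\<dots> \<le> (cmod (E$1$1 * v$1) + cmod (E$1$2 * v$2)) + (cmod (E$2$1 * v$1) + cmod (E$2$2 * v$2))"
    by (intro add_mono norm_triangle_ineq)
  also have "\<dots> \<le> (cmod (E$1$1) * norm v + cmod (E$1$2) * norm v) + (cmod (E$2$1) * norm v + cmod (E$2$2) * norm v)"
    unfolding norm_mult by (intro add_mono mult_left_mono Finite_Cartesian_Product.norm_nth_le) auto
  finally show ?thesis by (simp add: algebra_simps)
qed

text \<open>For a square root \<open>e\<close> of \<open>g\<close>, the product of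
  \<open>e - d\<close> and \<open>e + d\<close> is \<open>g - d^2\<close>, so the two factors cannot
  both have modulus at least \<open>\<delta>\<close>; hence \<open>e\<close> or \<open>- e\<close>
  is near \<open>d\<close>.\<close>

lemma square_root_near:
  assumes "cmod (g - d\<^sup>2) < \<delta>\<^sup>2" "\<delta> > 0"
  shows "\<exists>e. e\<^sup>2 = g \<and> cmod (e - d) < \<delta>"
proof (cases "cmod (csqrt g - d) < \<delta>")
  case False
  have "cmod (csqrt g + d) < \<delta>"
  proof (rule ccontr)
    assume "\<not> cmod (csqrt g + d) < \<delta>"
    hence "\<delta> * \<delta> \<le> cmod (csqrt g - d) * cmod (csqrt g + d)"
      using False assms by (intro mult_mono) auto
    also have "\<dots> = cmod ((csqrt g)\<^sup>2 - d\<^sup>2)"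
      by (simp add: norm_mult[symmetric] power2_eq_square algebra_simps del: power2_csqrt)
    also have "\<dots> < \<delta> * \<delta>" using assms by (simp add: power2_eq_square[of \<delta>])
    finally show False by simp
  qed
  hence "cmod (- csqrt g - d) < \<delta>" by (metis norm_minus_cancel minus_add_distrib uminus_add_conv_diff diff_conv_add_uminus)
  thus ?thesis by (intro exI[of _ "- csqrt g"]) simp
qed (auto intro!: exI[of _ "csqrt g"])

text \<open>Keep the entry \<open>b\<close> of \<open>A = [[h + d, b], [a, h - d]]\<close>; then \<open>d\<close> is a square root of a
  polynomial in the coordinates, and can be chosen near its old value.\<close>
lemma open_Pset: "open Pset"
proof (subst open_subopen, intro ballI)
  fix x assume "x \<in> Pset"
  then obtain A where A: "A \<in> Bmat" "x = piP A" unfolding Pset_def by blast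
  \<comment> \<open>The entries of the perturbation will add up to at most
    \<open>5 * \<delta>\<close>, which the gap of \<open>6 * \<delta>\<close> below 1
    absorbs.\<close>
  define \<delta> where "\<delta> = (1 - onorm (\<lambda>v. A *v v)) / 6"
  have \<delta>: "\<delta> > 0" using A by (simp add: \<delta>_def Bmat_def)
  define b d where "b = A$1$2" and "d = (A$1$1 - A$2$2) / 2"
  \<comment> \<open>The value that the square of half the diagonal difference must take if the
    matrix has upper right entry \<open>b\<close> and lies over \<open>y\<close>.\<close>
  define g where "g = (\<lambda>y :: complex \<times> complex \<times> complex. (fst (snd y))\<^sup>2 / 4 - snd (snd y) - b * fst y)"
  define U where "U = {y. cmod (fst y - fst x) < \<delta>} \<inter> {y. cmod (fst (snd y) - fst (snd x)) < \<delta>}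
    \<inter> {y. cmod (g y - d\<^sup>2) < \<delta>\<^sup>2}"
  have "open U"
    unfolding U_def g_def by (intro open_Int open_Collect_less continuous_intros) auto
  moreover have "x \<in> U"
  proof -
    have "g x = d\<^sup>2" by (simp add: g_def A(2) piP_2 b_def d_def field_simps power2_eq_square)
    thus ?thesis using \<delta> by (simp add: U_def)
  qed
  moreover have "U \<subseteq> Pset"
  proof
    fix y assume y: "y \<in> U"
    then obtain e where e: "e\<^sup>2 = g y" "cmod (e - d) < \<delta>"
      using square_root_near[OF _ \<delta>] unfolding U_def by blast
    define h where "h = fst (snd y) / 2"
    define A' :: "complex^2^2" where "A' = vector [vector [h + e, b], vector [fst y, h - e]]"
    have "fst (snd (piP A')) = fst (snd y)" "fst (piP A') = fst y"
      by (simp_all add: piP_2 A'_def h_def)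
    moreover have "snd (snd (piP A')) = snd (snd y)"
    proof -
      have "snd (snd (piP A')) = h\<^sup>2 - e\<^sup>2 - b * fst y"
        by (simp add: piP_2 A'_def algebra_simps power2_eq_square)
      thus ?thesis unfolding e g_def h_def by (simp add: power_divide)
    qed
    ultimately have "piP A' = y" by (simp add: prod_eq_iff)
    moreover have "A' \<in> Bmat"
    proof -
      define E where "E = A' - A"
      define h0 where "h0 = fst (snd x) / 2"
      have "cmod (h - h0) < \<delta>"
      proof -
        have "h - h0 = (fst (snd y) - fst (snd x)) / 2" by (simp add: h_def h0_def diff_divide_distrib)
        hence "cmod (h - h0) = cmod (fst (snd y) - fst (snd x)) / 2" by (simp only: norm_divide norm_numeral)
        also have "\<dots> < \<delta>" using y \<delta> unfolding U_def by simp
        finally show ?thesis .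
      qed
      have E: "E$1$1 = (h - h0) + (e - d)" "E$1$2 = 0" "E$2$1 = fst y - fst x" "E$2$2 = (h - h0) - (e - d)"
        by (simp_all add: E_def A'_def h0_def d_def b_def A(2) piP_2 field_simps)
      have "cmod (E$1$1) \<le> 2 * \<delta>" "cmod (E$2$2) \<le> 2 * \<delta>" "cmod (E$2$1) < \<delta>"
        unfolding E using norm_triangle_ineq[of "h - h0" "e - d"] norm_triangle_ineq4[of "h - h0" "e - d"]
          \<open>cmod (h - h0) < \<delta>\<close> e(2) y by (auto simp: U_def)
      hence sum: "cmod (E$1$1) + cmod (E$1$2) + cmod (E$2$1) + cmod (E$2$2) \<le> 5 * \<delta>" by (simp add: E(2))
      have "onorm (\<lambda>v. E *v v) \<le> 5 * \<delta>"
      proof (rule onorm_le)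
        fix v
        have "norm (E *v v) \<le> (cmod (E$1$1) + cmod (E$1$2) + cmod (E$2$1) + cmod (E$2$2)) * norm v"
          by (rule norm_matrix_vector_mult_2_le)
        also have "\<dots> \<le> 5 * \<delta> * norm v" by (rule mult_right_mono[OF sum]) simp
        finally show "norm (E *v v) \<le> 5 * \<delta> * norm v" .
      qed
      hence "onorm (\<lambda>v. A *v v + E *v v) < 1"
        using \<delta> by (intro onorm_triangle_lt bounded_linear_matrix_vector_mult_2) (simp add: \<delta>_def)
      thus ?thesis by (simp add: Bmat_def E_def matrix_vector_mult_diff_rdistrib)
    qed
    ultimately show "y \<in> Pset" unfolding Pset_def by blast
  qed
  ultimately show "\<exists>T. open T \<and> x \<in> T \<and> T \<subseteq> Pset" by blast
qed

lemma dilate_Pset_open: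
  assumes "r > 0" shows "open (dilate r ` Pset)"
proof -
  have "dilate r ` Pset = dilate (inverse r) -` Pset"
  proof (intro equalityI subsetI)
    fix y assume "y \<in> dilate (inverse r) -` Pset"
    moreover have "y = dilate r (dilate (inverse r) y)" using assms by (simp add: dilate_dilate)
    ultimately show "y \<in> dilate r ` Pset" by blast
  qed (use assms in \<open>auto simp: dilate_dilate\<close>)
  thus ?thesis using continuous_on_dilate open_Pset by (simp add: open_vimage)
qed

lemma dilate_Pset_mono:
  assumes "0 < r" "r \<le> t" shows "dilate r ` Pset \<subseteq> dilate t ` Pset"
proof
  fix y assume "y \<in> dilate r ` Pset"
  then obtain x where x: "x \<in> Pset" "y = dilate r x" by blast
  have "y = dilate t (dilate (r / t) x)" using assms x by (simp add: dilate_dilate)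
  moreover have "dilate (r / t) x \<in> Pset"
  \<comment> \<open>\<open>dilate_piP_contractive\<close> needs a factor strictly below 1; for equal
    factors the dilation is the identity.\<close>
  proof (cases "r = t")
    case False
    obtain A where "contractive A" "x = piP A" using x Bmat_contractive unfolding Pset_def by blast
    thus ?thesis using False assms by (auto intro!: dilate_piP_contractive)
  qed (use x assms in simp)
  ultimately show "y \<in> dilate t ` Pset" by blast
qed

lemma Pset_subset_dilates: "Pset \<subseteq> (\<Union>r\<in>{0<..<1}. dilate r ` Pset)"
proof
  fix x assume "x \<in> Pset"
  then obtain A where A: "A \<in> Bmat" "x = piP A" unfolding Pset_def by blast
  have "onorm (\<lambda>v. A *v v) \<ge> 0" by (rule onorm_pos_le[OF bounded_linear_matrix_vector_mult_2])
  then obtain r where r: "onorm (\<lambda>v. A *v v) < r" "r < 1" "0 < r"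
    using A dense[of "onorm (\<lambda>v. A *v v)" 1] by (auto simp: Bmat_def)
  have "onorm (\<lambda>v. (inverse r *\<^sub>R A) *v v) < 1"
    using r by (simp add: scaleR_matrix_vector_mult_2 onorm_scaleR[OF bounded_linear_matrix_vector_mult_2] field_simps)
  hence "piP (inverse r *\<^sub>R A) \<in> Pset" by (auto simp: Pset_def Bmat_def)
  moreover have "x = dilate r (piP (inverse r *\<^sub>R A))" using r A by (simp add: dilate_piP)
  ultimately show "x \<in> (\<Union>r\<in>{0<..<1}. dilate r ` Pset)" using r by auto
qed

text \<open>The dilates form an increasing open cover of \<open>Pset\<close>, so the largest member
  of a finite subcover contains \<open>K\<close>.\<close>

lemma compact_subset_dilate:
  assumes "compact K" "K \<subseteq> Pset"
  shows "\<exists>r\<in>{0<..<1}. K \<subseteq> dilate r ` Pset"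
proof -
  have "\<And>r. r \<in> {0<..<1} \<Longrightarrow> open (dilate r ` Pset)" by (simp add: dilate_Pset_open)
  then obtain F where F: "F \<subseteq> {0<..<1}" "finite F" "K \<subseteq> (\<Union>r\<in>F. dilate r ` Pset)"
    using compactE_image[OF assms(1), of "{0<..<1}" "\<lambda>r. dilate r ` Pset"] assms(2) Pset_subset_dilates
    by (metis (no_types, lifting) order_trans)
  \<comment> \<open>The value 1/2 guards against an empty \<open>F\<close>.\<close>
  define t where "t = Max (insert (1/2) F)"
  have t: "t \<in> {0<..<1}"
  proof -
    have "t \<in> insert (1/2) F" unfolding t_def using F(2) by (intro Max_in) auto
    thus ?thesis using F(1) by auto
  qed
  have "dilate r ` Pset \<subseteq> dilate t ` Pset" if "r \<in> F" for r
    using that F by (intro dilate_Pset_mono) (auto simp: t_def)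
  thus ?thesis using F(3) t by blast
qed

lemma poly3_dilate:
  assumes "poly3 f" shows "poly3 (\<lambda>x. f (dilate r x))"
proof -
  obtain n c where f: "f (x, y, z) = (\<Sum>i\<le>n. \<Sum>j\<le>n. \<Sum>k\<le>n. c i j k * x ^ i * y ^ j * z ^ k)" for x y z
    using assms unfolding poly3_def by blast
  show ?thesis unfolding poly3_def
    by (rule exI[of _ n], rule exI[of _ "\<lambda>i j k. c i j k * of_real r ^ i * of_real r ^ j * of_real (r\<^sup>2) ^ k"])
      (auto simp: dilate_def f power_mult_distrib mult_ac intro!: sum.cong)
qed

theorem theorem6p3:
  shows "(\<forall>x. x \<notin> closure Pset \<longrightarrow>
            (\<exists>f. poly3 f \<and> (\<forall>p\<in>closure Pset. norm (f p) \<le> 1) \<and> norm (f x) > 1))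
       \<and> (\<forall>K. compact K \<and> K \<subseteq> Pset \<longrightarrow> poly_hull K \<subseteq> Pset)"
proof (intro conjI allI impI subsetI)
  fix x assume "x \<notin> closure Pset"
  thus "\<exists>f. poly3 f \<and> (\<forall>p\<in>closure Pset. norm (f p) \<le> 1) \<and> norm (f x) > 1"
    by (rule closure_Pset_separation)
next
  fix K x assume K: "compact K \<and> K \<subseteq> Pset" and x: "x \<in> poly_hull K"
  obtain r where r: "0 < r" "r < 1" "K \<subseteq> dilate r ` Pset"
    using compact_subset_dilate K by (metis greaterThanLessThan_iff)
  \<comment> \<open>Undoing the dilation carries \<open>K\<close> into \<open>Pset\<close>, and it
    turns polynomials into polynomials. A polynomial separating the image of \<open>x\<close> from
    the closure would therefore separate \<open>x\<close> from \<open>K\<close>.\<close>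
  have "dilate (inverse r) x \<in> closure Pset"
  proof (rule ccontr)
    assume "dilate (inverse r) x \<notin> closure Pset"
    then obtain f where f: "poly3 f" "\<forall>p\<in>closure Pset. norm (f p) \<le> 1" "norm (f (dilate (inverse r) x)) > 1"
      using closure_Pset_separation by blast
    have "norm (f (dilate (inverse r) k)) \<le> 1" if "k \<in> K" for k
    proof -
      have "dilate (inverse r) k \<in> Pset" using that r by (auto simp: dilate_dilate)
      thus ?thesis using f(2) closure_subset by blast
    qed
    hence "norm (f (dilate (inverse r) x)) \<le> 1"
      using x poly3_dilate[OF f(1), of "inverse r"] unfolding poly_hull_def by blast
    thus False using f(3) by simp
  qed
  \<comment> \<open>The undilated point lifts to a contraction; scaling it by \<open>r < 1\<close>
    makes it strict and gives back \<open>x\<close>.\<close>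
  then obtain A where A: "contractive A" "dilate (inverse r) x = piP A"
    using closure_Pset_subset by blast
  have "x = dilate r (dilate (inverse r) x)" using r by (simp add: dilate_dilate)
  also have "\<dots> \<in> Pset" unfolding A(2) using A(1) r by (intro dilate_piP_contractive) auto
  finally show "x \<in> Pset" .
qed

end
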